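(* Let $L>0$, $b\ge0$, $K\ge1$, $d\ge2$. Consider the iGOGM-type method with coefficients $\alpha_0,\dots,\alpha_K$ (see context), started from a fixed $\mathbf{x}_0\in\mathbb{R}^d$, applied to functions in the class $\mathcal{F}_L(\mathbb{R}^d)$ of $L$-smooth convex functions on $\mathbb{R}^d$ (attaining their minimum $f^\star$) under the inexact-gradient oracle $\tilde\nabla f(\mathbf{x}_i)=\nabla f(\mathbf{x}_i)+\mathbf{e}_i$ with $\|\mathbf{e}_i\|\le b$, $i=0,\dots,K-1$. Let $\mathcal{E}_K(\rho)$ be the scalar curvature-dependent error-amplification quantity defined in the context. Then $$\sup_{f\in\mathcal{F}_L(\mathbb{R}^d)}\ \sup_{\|\mathbf{e}_i\|\le b}\{f(\mathbf{x}_K)-f^\star\}\ \ge\ \sup_{0\le\lambda\le L}\frac{\lambda b^2}{2L^2}\,\mathcal{E}_K(\lambda/L)^2.$$ In particular, for iOGM-$a$ with $a>0$, i.e. $\alpha_k=(k+a)/a$, $$\sup_{f\in\mathcal{F}_L(\mathbb{R}^d)}\ \sup_{\|\mathbf{e}_i\|\le b}\{f(\mathbf{x}_K)-f^\star\}\ \ge\ \Omega\left(\frac{b^2}{L}K^2\right),$$ i.e. there exist $c>0$ and $K_a\ge1$ depending only on $a$ such that the left-hand side is at least $c\,\frac{b^2}{L}K^2$ for all $K\ge K_a$.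
   Context: Method. Given nonnegative coefficients $\alpha_0=1,\alpha_1,\dots,\alpha_K$, put $A_k=\sum_{i=0}^k\alpha_i$, $\beta_{k}=\alpha_{k}/A_{k}$. (In iGOGM they are generated by $\alpha_{k+1}=\frac{\lambda_{k+1}+\sqrt{4\lambda_{k+1}A_k+\lambda_{k+1}^2}}{2}$, $\lambda_k\in[0,1]$, so that $\alpha_k^2=\lambda_kA_k$; in iOGM-$a$, $\alpha_k=(k+a)/a$ and $A_k=(k+1)(k+2a)/(2a)$.) Starting from $\mathbf{z}_0=\mathbf{x}_0$, for $k=0,\dots,K-1$: $$\mathbf{y}_{k+1}=\mathbf{x}_k-\tfrac1L\tilde\nabla f(\mathbf{x}_k),\quad \mathbf{z}_{k+1}=\mathbf{z}_k-\tfrac2L\alpha_k\tilde\nabla f(\mathbf{x}_k),\quad \mathbf{x}_{k+1}=(1-\beta_{k+1})\mathbf{y}_{k+1}+\beta_{k+1}\mathbf{z}_{k+1}.$$ Amplification quantity. For $\rho\in[0,1]$ and $i=0,\dots,K-1$ define $w_{k,i}(\rho),q_{k,i}(\rho)$ by $w_{i+1,i}(\rho)=1-\beta_{i+1}+2\alpha_i\beta_{i+1}$, $q_{i+1,i}(\rho)=2\alpha_i$, and for $k=i+1,\dots,K-1$ $$\begin{bmatrix}w_{k+1,i}(\rho)\\ q_{k+1,i}(\rho)\end{bmatrix}=\begin{bmatrix}(1-\beta_{k+1})(1-\rho)-2\alpha_k\beta_{k+1}\rho & \beta_{k+1}\\ -2\alpha_k\rho & 1\end{bmatrix}\begin{bmatrix}w_{k,i}(\rho)\\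 q_{k,i}(\rho)\end{bmatrix}.$$ Then $\mathcal{E}_K(\rho)=\sum_{i=0}^{K-1}|w_{K,i}(\rho)|$. "$L$-smooth" means differentiable with $L$-Lipschitz gradient. *)

theory Defs
  imports "HOL-Analysis.Analysis"
begin

section \<open>Euclidean spaces of all dimensions inside one type\<close>

text \<open>
  The asymptotic constants must not depend on the dimension \<open>d\<close>, so \<open>d\<close> has to be a number that is
  quantified inside a formula, not a type. All spaces are therefore realised inside the inner product
  space of finitely supported real sequences (with the \<open>l\<^sup>2\<close> inner product): \<open>Rd d\<close> is the set of
  sequences supported on \<open>{..<d}\<close>.
\<close>

typedef fin_seq = "{x :: nat \<Rightarrow> real. finite {i. x i \<noteq> 0}}"
  morphisms coord fin_seq_of
  by (rule exI[of _ "\<lambda>_. 0"]) simp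

lemma finite_support [simp]: "finite {i. coord x i \<noteq> 0}"
  using coord[of x] by simp

lemma fin_seq_eqI: "(\<And>i. coord x i = coord y i) \<Longrightarrow> x = y"
  by (metis coord_inject ext)

lemma coord_fin_seq_of: "finite {i. x i \<noteq> 0} \<Longrightarrow> coord (fin_seq_of x) = x"
  by (simp add: fin_seq_of_inverse)

instantiation fin_seq :: real_vector
begin

definition "0 = fin_seq_of (\<lambda>_. 0)"
definition "x + y = fin_seq_of (\<lambda>i. coord x i + coord y i)"
definition "- x = fin_seq_of (\<lambda>i. - coord x i)"
definition "x - y = fin_seq_of (\<lambda>i. coord x i - coord y i)"
definition "scaleR r x = fin_seq_of (\<lambda>i. r * coord x i)"

lemma coord_zero [simp]: "coord 0 i = 0"
  by (simp add: zero_fin_seq_def coord_fin_seq_of)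

lemma coord_add [simp]: "coord (x + y) i = coord x i + coord y i"
proof -
  have "finite {i. coord x i + coord y i \<noteq> 0}"
    by (rule finite_subset[of _ "{i. coord x i \<noteq> 0} \<union> {i. coord y i \<noteq> 0}"]) auto
  then show ?thesis by (simp add: plus_fin_seq_def coord_fin_seq_of)
qed

lemma coord_uminus [simp]: "coord (- x) i = - coord x i"
  by (simp add: uminus_fin_seq_def coord_fin_seq_of)

lemma coord_diff [simp]: "coord (x - y) i = coord x i - coord y i"
proof -
  have "finite {i. coord x i - coord y i \<noteq> 0}"
    by (rule finite_subset[of _ "{i. coord x i \<noteq> 0} \<union> {i. coord y i \<noteq> 0}"]) auto
  then show ?thesis by (simp add: minus_fin_seq_def coord_fin_seq_of)
qed

lemma coord_scaleR [simp]: "coord (r *\<^sub>R x) i = r * coord x i"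
proof -
  have "finite {i. r * coord x i \<noteq> 0}"
    by (rule finite_subset[of _ "{i. coord x i \<noteq> 0}"]) auto
  then show ?thesis by (simp add: scaleR_fin_seq_def coord_fin_seq_of)
qed

instance
  by standard (auto intro!: fin_seq_eqI simp: algebra_simps)

end

instantiation fin_seq :: real_inner
begin

definition inner_fin_seq :: "fin_seq \<Rightarrow> fin_seq \<Rightarrow> real"
  where "inner_fin_seq x y = (\<Sum>i | coord x i \<noteq> 0. coord x i * coord y i)"
definition norm_fin_seq :: "fin_seq \<Rightarrow> real"
  where "norm_fin_seq x = sqrt (inner x x)"
definition sgn_fin_seq :: "fin_seq \<Rightarrow> fin_seq"
  where "sgn_fin_seq x = inverse (norm x) *\<^sub>R x"
definition dist_fin_seq :: "fin_seq \<Rightarrow> fin_seq \<Rightarrow> real"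
  where "dist_fin_seq x y = norm (x - y)"
definition uniformity_fin_seq :: "(fin_seq \<times> fin_seq) filter"
  where "uniformity_fin_seq = (INF e\<in>{0<..}. principal {(x, y). dist x y < e})"
definition open_fin_seq :: "fin_seq set \<Rightarrow> bool"
  where "open_fin_seq U \<longleftrightarrow> (\<forall>x\<in>U. eventually (\<lambda>(x', y). x' = x \<longrightarrow> y \<in> U) uniformity)"

lemma inner_fin_seq_superset:
  assumes "finite S" "{i. coord x i \<noteq> 0} \<subseteq> S"
  shows "inner x y = (\<Sum>i\<in>S. coord x i * coord y i)"
  unfolding inner_fin_seq_def using assms by (intro sum.mono_neutral_left) auto

instance
proof
  fix x y z :: fin_seq and r :: real
  let ?S = "{i. coord x i \<noteq> 0} \<union> {i. coord y i \<noteq> 0}"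
  show "inner x y = inner y x"
    using inner_fin_seq_superset[of ?S x y] inner_fin_seq_superset[of ?S y x]
    by (simp add: mult.commute)
  have "inner (x + y) z = (\<Sum>i\<in>?S. coord (x + y) i * coord z i)"
    by (rule inner_fin_seq_superset) auto
  also have "\<dots> = (\<Sum>i\<in>?S. coord x i * coord z i) + (\<Sum>i\<in>?S. coord y i * coord z i)"
    by (simp add: distrib_right sum.distrib)
  also have "\<dots> = inner x z + inner y z"
    using inner_fin_seq_superset[of ?S x z] inner_fin_seq_superset[of ?S y z] by simp
  finally show "inner (x + y) z = inner x z + inner y z" .
  have "inner (r *\<^sub>R x) y = (\<Sum>i\<in>?S. coord (r *\<^sub>R x) i * coord y i)"
    by (rule inner_fin_seq_superset) auto
  also have "\<dots> = r * (\<Sum>i\<in>?S. coord x i * coord y i)"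
    by (simp add: sum_distrib_left mult.assoc)
  also have "\<dots> = r * inner x y"
    using inner_fin_seq_superset[of ?S x y] by simp
  finally show "inner (r *\<^sub>R x) y = r * inner x y" .
  show "0 \<le> inner x x"
    unfolding inner_fin_seq_def by (intro sum_nonneg) simp
  show "inner x x = 0 \<longleftrightarrow> x = 0"
  proof
    assume "inner x x = 0"
    then have "\<forall>i\<in>{i. coord x i \<noteq> 0}. coord x i * coord x i = 0"
      unfolding inner_fin_seq_def
      using sum_nonneg_eq_0_iff[of "{i. coord x i \<noteq> 0}" "\<lambda>i. coord x i * coord x i"] by simp
    then show "x = 0" by (intro fin_seq_eqI) auto
  qed (simp add: inner_fin_seq_def)
qed (simp_all add: norm_fin_seq_def sgn_fin_seq_def dist_fin_seq_def uniformity_fin_seq_def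
      open_fin_seq_def)

end

definition Rd :: "nat \<Rightarrow> fin_seq set"
  where "Rd d = {x. \<forall>i\<ge>d. coord x i = 0}"

lemma subspace_Rd: "subspace (Rd d)"
  by (auto simp: subspace_def Rd_def)

lemma inner_Rd:
  assumes "x \<in> Rd d"
  shows "inner x y = (\<Sum>i<d. coord x i * coord y i)"
proof (rule inner_fin_seq_superset)
  show "{i. coord x i \<noteq> 0} \<subseteq> {..<d}"
    using assms not_le unfolding Rd_def by blast
qed simp

lemma norm_Rd:
  assumes "x \<in> Rd d"
  shows "norm x = L2_set (coord x) {..<d}"
  using inner_Rd[OF assms, of x] by (simp add: norm_fin_seq_def L2_set_def power2_eq_square)

lemma coord_surj_Rd: "bij_betw coord (Rd d) {x. \<forall>i\<ge>d. x i = 0}"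
proof (rule bij_betwI[of _ _ _ fin_seq_of])
  have fin: "finite {i. x i \<noteq> 0}" if "\<forall>i\<ge>d. x i = 0" for x :: "nat \<Rightarrow> real"
  proof (rule finite_subset)
    show "{i. x i \<noteq> 0} \<subseteq> {..<d}" using that not_le by blast
  qed simp
  show "fin_seq_of \<in> {x. \<forall>i\<ge>d. x i = 0} \<rightarrow> Rd d"
    using fin by (auto simp: Rd_def coord_fin_seq_of)
  show "coord (fin_seq_of x) = x" if "x \<in> {x. \<forall>i\<ge>d. x i = 0}" for x
    using that fin by (simp add: coord_fin_seq_of)
qed (auto simp: Rd_def coord_inverse)


section \<open>Smooth convex functions\<close>

text \<open>
  Functions on the space \<open>V\<close> (a subspace) are total functions whose values outside \<open>V\<close> are never
  used; derivatives are taken within \<open>V\<close>, which makes the gradient in \<open>V\<close> unique.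
\<close>

definition has_gradient_in :: "'a::real_inner set \<Rightarrow> ('a \<Rightarrow> real) \<Rightarrow> 'a \<Rightarrow> 'a \<Rightarrow> bool"
  where "has_gradient_in V f x g \<longleftrightarrow>
    g \<in> V \<and> (f has_derivative (\<lambda>h. inner g h)) (at x within V)"

definition gradient_in :: "'a::real_inner set \<Rightarrow> ('a \<Rightarrow> real) \<Rightarrow> 'a \<Rightarrow> 'a"
  where "gradient_in V f x = (THE g. has_gradient_in V f x g)"

definition smooth_convex_on :: "real \<Rightarrow> 'a::real_inner set \<Rightarrow> ('a \<Rightarrow> real) set"
  where "smooth_convex_on L V = {f.
    convex_on V f \<and>
    (\<forall>x\<in>V. \<exists>g. has_gradient_in V f x g) \<and>
    L-lipschitz_on V (gradient_in V f) \<and>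
    (\<exists>x\<in>V. \<forall>y\<in>V. f x \<le> f y)}"


section \<open>The method with inexact gradients\<close>

definition Asum :: "(nat \<Rightarrow> real) \<Rightarrow> nat \<Rightarrow> real"
  where "Asum \<alpha> k = (\<Sum>i\<le>k. \<alpha> i)"

definition bet :: "(nat \<Rightarrow> real) \<Rightarrow> nat \<Rightarrow> real"
  where "bet \<alpha> k = \<alpha> k / Asum \<alpha> k"

text \<open>The pair of iterates \<open>(x\<^sub>k, z\<^sub>k)\<close>; \<open>G\<close> is the exact gradient and \<open>e k\<close> the error at step \<open>k\<close>.\<close>

primrec iterates :: "real \<Rightarrow> (nat \<Rightarrow> real) \<Rightarrow> ('a::real_vector \<Rightarrow> 'a) \<Rightarrow> (nat \<Rightarrow> 'a) \<Rightarrow> 'a \<Rightarrow> nat \<Rightarrow> 'a \<times> 'a"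
  where
    "iterates L \<alpha> G e x0 0 = (x0, x0)"
  | "iterates L \<alpha> G e x0 (Suc k) =
      (let (x, z) = iterates L \<alpha> G e x0 k;
           g = G x + e k;
           y' = x - (1 / L) *\<^sub>R g;
           z' = z - (2 / L * \<alpha> k) *\<^sub>R g;
           x' = (1 - bet \<alpha> (Suc k)) *\<^sub>R y' + bet \<alpha> (Suc k) *\<^sub>R z'
       in (x', z'))"

text \<open>
  The worst-case value of \<open>f x\<^sub>K - f\<^sup>\<star>\<close> is an extended real: the class contains functions whose
  minimisers are arbitrarily far from \<open>x0\<close>, so the supremum need not be finite.
\<close>

definition worst_case_gap ::
    "real \<Rightarrow> real \<Rightarrow> 'a::real_inner set \<Rightarrow> (nat \<Rightarrow> real) \<Rightarrow> 'a \<Rightarrow> nat \<Rightarrow> ereal"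
  where "worst_case_gap L b V \<alpha> x0 K =
    (SUP f\<in>smooth_convex_on L V. SUP e\<in>{e. \<forall>i<K. e i \<in> V \<and> norm (e i) \<le> b}.
       ereal (f (fst (iterates L \<alpha> (gradient_in V f) e x0 K)) - (INF x\<in>V. f x)))"


section \<open>Error amplification\<close>

text \<open>
  \<open>wq \<alpha> \<rho> i k\<close> is the pair \<open>(w\<^bsub>k,i\<^esub>(\<rho>), q\<^bsub>k,i\<^esub>(\<rho>))\<close> for \<open>k > i\<close>; for \<open>k \<le> i\<close> it is a dummy value that
  is not used. For \<open>k > i\<close> the step is the product of the transition matrix with \<open>(w, q)\<close>.
\<close>

primrec wq :: "(nat \<Rightarrow> real) \<Rightarrow> real \<Rightarrow> nat \<Rightarrow> nat \<Rightarrow> real \<times> real"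
  where
    "wq \<alpha> \<rho> i 0 = (0, 0)"
  | "wq \<alpha> \<rho> i (Suc k) =
      (if k < i then (0, 0)
       else if k = i then (1 - bet \<alpha> (Suc i) + 2 * \<alpha> i * bet \<alpha> (Suc i), 2 * \<alpha> i)
       else (let (w, q) = wq \<alpha> \<rho> i k in
         (((1 - bet \<alpha> (Suc k)) * (1 - \<rho>) - 2 * \<alpha> k * bet \<alpha> (Suc k) * \<rho>) * w + bet \<alpha> (Suc k) * q,
          - 2 * \<alpha> k * \<rho> * w + q)))"

definition amplification :: "(nat \<Rightarrow> real) \<Rightarrow> nat \<Rightarrow> real \<Rightarrow> real"
  where "amplification \<alpha> K \<rho> = (\<Sum>i<K. \<bar>fst (wq \<alpha> \<rho> i K)\<bar>)"

end

theory Submission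
  imports Defs
begin

text \<open>
  For the quadratic \<open>f x = l/2 * \<parallel>x - x0\<parallel>\<^sup>2\<close> the method is linear in the errors, and the
  coefficients of \<open>e i\<close> in the iterates are \<open>- w / L\<close> and \<open>- q / L\<close>. Taking all errors parallel to one
  unit vector, with signs such that the contributions add up, gives the first bound.

  For the second one take \<open>l = L / (4 * A\<^sub>K)\<close>. The recursion can be rewritten as
  \<open>w\<^bsub>k+1\<^esub> = (1 - \<beta>\<^bsub>k+1\<^esub>) * (1 - \<rho>) * w\<^sub>k + \<beta>\<^bsub>k+1\<^esub> * q\<^bsub>k+1\<^esub>\<close>, and for this \<open>\<rho>\<close> the
  momentum \<open>q\<^sub>k\<close> stays between \<open>\<alpha>\<^sub>i\<close> and \<open>2 * \<alpha>\<^sub>i\<close>. Hence \<open>A\<^sub>K * w\<^bsub>K,i\<^esub> \<ge> \<alpha>\<^sub>i * (A\<^sub>K - A\<^sub>i) / 2\<close>,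
  and summing over \<open>i\<close> shows that the amplification is of order \<open>A\<^sub>K\<close>, which is quadratic in \<open>K\<close>.
\<close>

section \<open>Gradients relative to a subspace, and quadratics in the smooth convex class\<close>

text \<open>Restricting \<open>f\<close> to the line through \<open>x\<close> in direction
  \<open>g - h\<close>, which stays inside \<open>V\<close>, gives a function of one real variable.
  Its derivative at 0 is unique, so \<open>g\<close> and \<open>h\<close> have the same inner
  product with \<open>g - h\<close>, which must then vanish.\<close>

lemma has_gradient_in_unique:
  assumes "subspace V" "x \<in> V" "has_gradient_in V f x g" "has_gradient_in V f x h"
  shows "g = h"
proof -
  define v where "v = g - h"
  have v: "v \<in> V"
    using assms by (simp add: v_def has_gradient_in_def subspace_diff)
  have line: "((\<lambda>t::real. f (x + t *\<^sub>R v)) has_derivative (\<lambda>t. inner p (t *\<^sub>R v))) (at 0)"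
    if "has_gradient_in V f x p" for p
  proof -
    have "((\<lambda>t::real. x + t *\<^sub>R v) has_derivative (\<lambda>t. t *\<^sub>R v)) (at 0)"
      by (auto intro!: derivative_eq_intros)
    \<comment> \<open>The base point is written \<open>x + 0 *\<^sub>R v\<close> to match the chain
      rule, which needs \<open>f\<close> differentiated only along the image of the line.\<close>
    moreover have "(f has_derivative inner p) (at (x + 0 *\<^sub>R v) within range (\<lambda>t::real. x + t *\<^sub>R v))"
      using that v assms(1,2) unfolding has_gradient_in_def
      by (auto intro!: has_derivative_subset[where s = V] simp: subspace_add subspace_scale)
    ultimately show ?thesis
      by (rule has_derivative_in_compose)
  qed
  have "inner g v = inner h v"
    using fun_cong[OF has_derivative_unique[OF line line], OF assms(3,4), of 1] by simp
  then have "inner v v = 0"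
    by (simp add: v_def inner_diff_left)
  then show ?thesis
    by (simp add: v_def)
qed

lemma gradient_in_eqI:
  assumes "subspace V" "x \<in> V" "has_gradient_in V f x g"
  shows "gradient_in V f x = g"
  unfolding gradient_in_def using assms has_gradient_in_unique by (intro the_equality) blast+

lemma has_gradient_in_quadratic:
  assumes "subspace V" "c \<in> V" "x \<in> V"
  shows "has_gradient_in V (\<lambda>x. l / 2 * (norm (x - c))\<^sup>2) x (l *\<^sub>R (x - c))"
  unfolding has_gradient_in_def power2_norm_eq_inner
  using assms
  by (auto intro!: derivative_eq_intros simp: subspace_diff subspace_scale inner_commute)

lemma convex_on_quadratic:
  fixes V :: "'a::real_inner set"
  assumes "convex V" "l \<ge> 0"
  shows "convex_on V (\<lambda>x. l / 2 * (norm (x - c))\<^sup>2)"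
proof (rule convex_onI)
  fix t :: real and x y
  assume t: "0 < t" "t < 1"
  define p q where "p = x - c" and "q = y - c"
  have pq: "(1 - t) *\<^sub>R x + t *\<^sub>R y - c = (1 - t) *\<^sub>R p + t *\<^sub>R q"
    by (simp add: p_def q_def algebra_simps)
  have "(norm ((1 - t) *\<^sub>R p + t *\<^sub>R q))\<^sup>2 =
      (1 - t) * (norm p)\<^sup>2 + t * (norm q)\<^sup>2 - t * (1 - t) * (norm (p - q))\<^sup>2"
    unfolding power2_norm_eq_inner inner_add_left inner_add_right inner_diff_left inner_diff_right
      inner_scaleR_left inner_scaleR_right inner_commute[of q p]
    by algebra
  then have "(norm ((1 - t) *\<^sub>R x + t *\<^sub>R y - c))\<^sup>2 =
      (1 - t) * (norm (x - c))\<^sup>2 + t * (norm (y - c))\<^sup>2 - t * (1 - t) * (norm (p - q))\<^sup>2"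
    unfolding pq by (simp add: p_def q_def)
  also have "\<dots> \<le> (1 - t) * (norm (x - c))\<^sup>2 + t * (norm (y - c))\<^sup>2"
    using t by simp
  finally have "l / 2 * (norm ((1 - t) *\<^sub>R x + t *\<^sub>R y - c))\<^sup>2 \<le>
      l / 2 * ((1 - t) * (norm (x - c))\<^sup>2 + t * (norm (y - c))\<^sup>2)"
    using assms(2) by (intro mult_left_mono) auto
  also have "\<dots> = (1 - t) * (l / 2 * (norm (x - c))\<^sup>2) + t * (l / 2 * (norm (y - c))\<^sup>2)"
    by (simp only: distrib_left mult_ac)
  finally show "l / 2 * (norm ((1 - t) *\<^sub>R x + t *\<^sub>R y - c))\<^sup>2 \<le>
      (1 - t) * (l / 2 * (norm (x - c))\<^sup>2) + t * (l / 2 * (norm (y - c))\<^sup>2)" .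
qed (use assms in auto)

lemma quadratic_smooth_convex_on:
  assumes "subspace V" "c \<in> V" "0 \<le> l" "l \<le> L"
  shows "(\<lambda>x. l / 2 * (norm (x - c))\<^sup>2) \<in> smooth_convex_on L V"
proof -
  let ?f = "\<lambda>x. l / 2 * (norm (x - c))\<^sup>2"
  have grad: "gradient_in V ?f x = l *\<^sub>R (x - c)" if "x \<in> V" for x
    using assms that by (intro gradient_in_eqI has_gradient_in_quadratic)
  have "L-lipschitz_on V (gradient_in V ?f)"
  proof (rule lipschitz_onI)
    fix x y assume "x \<in> V" "y \<in> V"
    then have "dist (gradient_in V ?f x) (gradient_in V ?f y) = l * dist x y"
      using assms unfolding grad[OF \<open>x \<in> V\<close>] grad[OF \<open>y \<in> V\<close>]
      by (simp add: dist_norm flip: scaleR_diff_right)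
    also have "\<dots> \<le> L * dist x y"
      using assms by (intro mult_right_mono) auto
    finally show "dist (gradient_in V ?f x) (gradient_in V ?f y) \<le> L * dist x y" .
  qed (use assms in simp)
  moreover have "\<forall>y\<in>V. ?f c \<le> ?f y"
    using assms by simp
  ultimately show ?thesis
    unfolding smooth_convex_on_def
    using assms convex_on_quadratic[OF subspace_imp_convex] has_gradient_in_quadratic by blast
qed

section \<open>The method on a quadratic centred at the starting point\<close>

text \<open>Since \<open>G\<close> is linear in the displacement from \<open>x0\<close> and the
  method starts at \<open>x0\<close>, the displacement is a pure superposition of responses to the
  errors. The matrix in \<open>wq\<close> propagates old errors, and its initial pair is the
  response to a fresh one. As \<open>G\<close> is known only on \<open>V\<close>, the induction also
  has to see that the iterates stay there.\<close>

lemma iterates_quadratic: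
  assumes V: "subspace V" "x0 \<in> V" and G: "\<And>x. x \<in> V \<Longrightarrow> G x = l *\<^sub>R (x - x0)"
    and e: "\<And>i. i < K \<Longrightarrow> e i \<in> V" and L: "L > 0" and "k \<le> K"
  shows "iterates L \<alpha> G e x0 k =
    (x0 - (\<Sum>i<k. (fst (wq \<alpha> (l / L) i k) / L) *\<^sub>R e i),
     x0 - (\<Sum>i<k. (snd (wq \<alpha> (l / L) i k) / L) *\<^sub>R e i))"
  using \<open>k \<le> K\<close>
proof (induction k)
  case 0
  show ?case by simp
next
  case (Suc k)
  let ?w = "\<lambda>i. fst (wq \<alpha> (l / L) i k)" and ?q = "\<lambda>i. snd (wq \<alpha> (l / L) i k)"
  define B where "B = bet \<alpha> (Suc k)"
  define X Z where "X = (\<Sum>i<k. (?w i / L) *\<^sub>R e i)" and "Z = (\<Sum>i<k. (?q i / L) *\<^sub>R e i)"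
  have IH: "iterates L \<alpha> G e x0 k = (x0 - X, x0 - Z)"
    using Suc by (simp add: X_def Z_def)
  have "X \<in> V"
    unfolding X_def using Suc.prems V e by (intro subspace_sum subspace_scale) auto
  then have GX: "G (x0 - X) = - (l *\<^sub>R X)"
    using V by (simp add: G subspace_diff)
  \<comment> \<open>Here \<open>i < k\<close>, so the matrix clause of \<open>wq\<close> applies to
    each summand; the index \<open>i = k\<close> is added separately in \<open>new\<close>.\<close>
  have w: "(\<Sum>i<k. (fst (wq \<alpha> (l / L) i (Suc k)) / L) *\<^sub>R e i) =
      ((1 - B) * (1 - l / L) - 2 * \<alpha> k * B * (l / L)) *\<^sub>R X + B *\<^sub>R Z"
    unfolding X_def Z_def scaleR_sum_right sum.distrib[symmetric]
    by (rule sum.cong) (auto simp: case_prod_unfold Let_def B_def add_divide_distrib scaleR_add_left)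
  have q: "(\<Sum>i<k. (snd (wq \<alpha> (l / L) i (Suc k)) / L) *\<^sub>R e i) =
      (- 2 * \<alpha> k * (l / L)) *\<^sub>R X + Z"
    unfolding X_def Z_def scaleR_sum_right sum.distrib[symmetric]
    by (rule sum.cong)
      (auto simp: case_prod_unfold Let_def add_divide_distrib diff_divide_distrib scaleR_left.diff)
  define Y where "Y = (1 / L) *\<^sub>R e k"
  have g: "(1 / L) *\<^sub>R (- (l *\<^sub>R X) + e k) = Y - (l / L) *\<^sub>R X"
    "(2 / L * \<alpha> k) *\<^sub>R (- (l *\<^sub>R X) + e k) = (2 * \<alpha> k) *\<^sub>R (Y - (l / L) *\<^sub>R X)"
    by (simp_all add: Y_def algebra_simps)
  have scale: "(r / L) *\<^sub>R e k = r *\<^sub>R Y" for r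
    by (simp add: Y_def)
  have new: "(fst (wq \<alpha> (l / L) k (Suc k)) / L) *\<^sub>R e k = (1 - B + 2 * \<alpha> k * B) *\<^sub>R Y"
    "(snd (wq \<alpha> (l / L) k (Suc k)) / L) *\<^sub>R e k = (2 * \<alpha> k) *\<^sub>R Y"
    unfolding scale by (simp_all add: B_def)
  show ?case
    unfolding iterates.simps IH sum.lessThan_Suc w q new
      Let_def prod.case GX g B_def[symmetric]
    by (simp add: algebra_simps)
qed

text \<open>The bound is the exact gap of one instance: with the errors below, the last iterate is
  \<open>x0\<close> displaced by \<open>b / L * E\<close> along \<open>u\<close>.\<close>

lemma worst_case_gap_ge:
  assumes V: "subspace V" "x0 \<in> V" and u: "u \<in> V" "norm u = 1"
    and L: "L > 0" and b: "b \<ge> 0" and l: "0 \<le> l" "l \<le> L"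
  shows "ereal (l * b\<^sup>2 / (2 * L\<^sup>2) * (amplification \<alpha> K (l / L))\<^sup>2) \<le> worst_case_gap L b V \<alpha> x0 K"
proof -
  define f where "f = (\<lambda>x. l / 2 * (norm (x - x0))\<^sup>2)"
  define w where "w i = fst (wq \<alpha> (l / L) i K)" for i
  define e where "e i = (b * sgn (w i)) *\<^sub>R u" for i
  define E where "E = amplification \<alpha> K (l / L)"
  have f: "f \<in> smooth_convex_on L V"
    unfolding f_def using V l by (rule quadratic_smooth_convex_on)
  have eV: "e i \<in> V" for i
    using V u by (simp add: e_def subspace_scale)
  have "norm (e i) \<le> b" for i
    using u b by (simp add: e_def abs_mult abs_sgn_eq)
  then have e: "e \<in> {e. \<forall>i<K. e i \<in> V \<and> norm (e i) \<le> b}"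
    using eV by simp
  have grad: "gradient_in V f x = l *\<^sub>R (x - x0)" if "x \<in> V" for x
    unfolding f_def using V that by (intro gradient_in_eqI has_gradient_in_quadratic)
  have "fst (iterates L \<alpha> (gradient_in V f) e x0 K) = x0 - (\<Sum>i<K. (w i / L) *\<^sub>R e i)"
    using V L eV
    by (subst iterates_quadratic[where K = K and V = V and l = l])
      (auto simp: w_def grad)
  also have "(\<Sum>i<K. (w i / L) *\<^sub>R e i) = (b / L * E) *\<^sub>R u"
    unfolding E_def amplification_def e_def w_def[symmetric] sum_distrib_left scaleR_sum_left
    by (rule sum.cong) (auto simp: abs_sgn mult_ac)
  finally have gap: "f (fst (iterates L \<alpha> (gradient_in V f) e x0 K)) = l * b\<^sup>2 / (2 * L\<^sup>2) * E\<^sup>2"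
    using u by (simp add: f_def power_mult_distrib power_divide)
  \<comment> \<open>This infimum is taken over the reals, so it is evaluated through the attained
    minimum at \<open>x0\<close>.\<close>
  have inf: "(INF x\<in>V. f x) = 0"
  proof (rule cInf_eq_minimum)
    show "0 \<in> f ` V"
      using V by (intro image_eqI[of _ _ x0]) (auto simp: f_def)
  qed (use l in \<open>auto simp: f_def\<close>)
  show ?thesis
    unfolding worst_case_gap_def E_def[symmetric]
    by (rule SUP_upper2[OF f], rule SUP_upper2[OF e]) (simp add: gap inf)
qed

section \<open>Lower bound on the amplification for coefficients at least 1\<close>

lemma Asum_Suc: "Asum \<alpha> (Suc k) = Asum \<alpha> k + \<alpha> (Suc k)"
  by (simp add: Asum_def)

text \<open>The negative term of the matrix entry is absorbed into the updated \<open>q\<close>. For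
  \<rho> in [0,1] nonnegativity of \<open>w\<close> then follows from that of the new
  \<open>q\<close>.\<close>

lemma fst_wq_Suc:
  assumes "i < k"
  shows "fst (wq \<alpha> \<rho> i (Suc k)) =
    (1 - bet \<alpha> (Suc k)) * (1 - \<rho>) * fst (wq \<alpha> \<rho> i k) + bet \<alpha> (Suc k) * snd (wq \<alpha> \<rho> i (Suc k))"
  using assms by (simp add: case_prod_unfold Let_def algebra_simps)

lemma snd_wq_Suc:
  assumes "i < k"
  shows "snd (wq \<alpha> \<rho> i (Suc k)) = snd (wq \<alpha> \<rho> i k) - 2 * \<alpha> k * \<rho> * fst (wq \<alpha> \<rho> i k)"
  using assms by (simp add: case_prod_unfold Let_def)

declare wq.simps(2) [simp del]

context
  fixes \<alpha> :: "nat \<Rightarrow> real"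
  assumes alpha_ge_1: "\<And>k. \<alpha> k \<ge> 1"
begin

lemma Asum_mono: "i \<le> k \<Longrightarrow> Asum \<alpha> i \<le> Asum \<alpha> k"
  unfolding Asum_def using order_trans[OF zero_le_one alpha_ge_1] by (intro sum_mono2) auto

lemma Asum_ge_1: "Asum \<alpha> k \<ge> 1"
  using Asum_mono[of 0 k] alpha_ge_1[of 0] by (simp add: Asum_def)

lemma bet_bounds: "0 \<le> bet \<alpha> k" "bet \<alpha> k \<le> 1"
proof -
  have "\<alpha> k \<le> Asum \<alpha> k"
    unfolding Asum_def using order_trans[OF zero_le_one alpha_ge_1] by (intro member_le_sum) auto
  then show "0 \<le> bet \<alpha> k" "bet \<alpha> k \<le> 1"
    using Asum_ge_1[of k] alpha_ge_1[of k] by (auto simp: bet_def)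
qed

lemma Asum_bet: "Asum \<alpha> k * bet \<alpha> k = \<alpha> k"
  using Asum_ge_1[of k] by (simp add: bet_def)

text \<open>The bounds feed each other: the upper bound on \<open>w\<close> limits how fast
  \<open>q\<close> decreases, and \<open>q\<close> staying at least \<open>\<alpha> i\<close> makes
  \<open>w\<close> grow. The difference \<open>Asum \<alpha> k - \<alpha> k\<close> is the previous
  partial sum, since \<open>q\<close> at \<open>k\<close> has been reduced only by steps before
  \<open>k\<close>.\<close>

lemma wq_bounds:
  assumes \<rho>: "0 \<le> \<rho>" "4 * \<rho> * Asum \<alpha> K \<le> 1" and k: "Suc i \<le> k" "k \<le> K"
  shows "0 \<le> fst (wq \<alpha> \<rho> i k) \<and> fst (wq \<alpha> \<rho> i k) \<le> 2 * \<alpha> i \<and>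
    2 * \<alpha> i * (1 - 2 * \<rho> * (Asum \<alpha> k - \<alpha> k)) \<le> snd (wq \<alpha> \<rho> i k) \<and>
    snd (wq \<alpha> \<rho> i k) \<le> 2 * \<alpha> i \<and>
    \<alpha> i * (Asum \<alpha> k - Asum \<alpha> i) / 2 \<le> Asum \<alpha> k * fst (wq \<alpha> \<rho> i k)"
  using k
proof (induction k rule: dec_induct)
  case base
  define B where "B = bet \<alpha> (Suc i)"
  have wq: "wq \<alpha> \<rho> i (Suc i) = (1 - B + 2 * \<alpha> i * B, 2 * \<alpha> i)"
    by (simp add: B_def wq.simps(2))
  have B: "0 \<le> B" "B \<le> 1"
    using bet_bounds by (auto simp: B_def)
  \<comment> \<open>The product equals \<open>2 * \<alpha> i\<close> minus the initial
    \<open>w\<close>.\<close>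
  have "(2 * \<alpha> i - 1) * (1 - B) \<ge> 0"
    using alpha_ge_1[of i] B by simp
  then have le: "1 - B + 2 * \<alpha> i * B \<le> 2 * \<alpha> i"
    by (simp add: algebra_simps)
  have nonneg: "0 \<le> 1 - B + 2 * \<alpha> i * B"
    using alpha_ge_1[of i] B by simp
  have "\<alpha> i * \<alpha> (Suc i) / 2 \<le> 2 * \<alpha> i * \<alpha> (Suc i)"
    using alpha_ge_1[of i] alpha_ge_1[of "Suc i"] by simp
  also have "\<dots> = Asum \<alpha> (Suc i) * (2 * \<alpha> i * B)"
    using Asum_bet[of "Suc i"] by (simp add: B_def algebra_simps)
  also have "\<dots> \<le> Asum \<alpha> (Suc i) * (1 - B + 2 * \<alpha> i * B)"
    using Asum_ge_1[of "Suc i"] B by (intro mult_left_mono) auto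
  finally have "\<alpha> i * \<alpha> (Suc i) / 2 \<le> Asum \<alpha> (Suc i) * (1 - B + 2 * \<alpha> i * B)" .
  moreover have "2 * \<alpha> i * (1 - 2 * \<rho> * Asum \<alpha> i) \<le> 2 * \<alpha> i"
    using alpha_ge_1[of i] Asum_ge_1[of i] \<rho> by (simp add: algebra_simps)
  ultimately show ?case
    using le nonneg by (simp add: wq Asum_Suc)
next
  case (step k)
  define w q w' q' B where "w = fst (wq \<alpha> \<rho> i k)" and "q = snd (wq \<alpha> \<rho> i k)"
    and "w' = fst (wq \<alpha> \<rho> i (Suc k))" and "q' = snd (wq \<alpha> \<rho> i (Suc k))"
    and "B = bet \<alpha> (Suc k)"
  have w': "w' = (1 - B) * (1 - \<rho>) * w + B * q'" and q': "q' = q - 2 * \<alpha> k * \<rho> * w"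
    using step.hyps by (auto simp: w_def q_def w'_def q'_def B_def fst_wq_Suc snd_wq_Suc)
  have IH: "0 \<le> w" "w \<le> 2 * \<alpha> i" "2 * \<alpha> i * (1 - 2 * \<rho> * (Asum \<alpha> k - \<alpha> k)) \<le> q" "q \<le> 2 * \<alpha> i"
    "\<alpha> i * (Asum \<alpha> k - Asum \<alpha> i) / 2 \<le> Asum \<alpha> k * w"
    using step by (auto simp: w_def q_def)
  have B: "0 \<le> B" "B \<le> 1"
    using bet_bounds by (auto simp: B_def)
  have a: "\<alpha> i \<ge> 1" "\<alpha> k \<ge> 1" "\<alpha> (Suc k) \<ge> 1"
    using alpha_ge_1 by auto
  have "\<rho> * Asum \<alpha> k \<le> \<rho> * Asum \<alpha> K"
    using step.prems \<rho> by (intro mult_left_mono Asum_mono) auto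
  then have \<rho>A: "\<rho> * Asum \<alpha> k \<le> 1 / 4"
    using \<rho> by linarith
  have "\<rho> * 1 \<le> \<rho> * Asum \<alpha> k"
    using \<rho> Asum_ge_1 by (intro mult_left_mono) auto
  then have \<rho>1: "\<rho> \<le> 1"
    using \<rho>A by linarith
  \<comment> \<open>One step lowers \<open>q\<close> by at most
    \<open>4 * \<alpha> k * \<rho> * \<alpha> i\<close>, exactly the amount by which its claimed
    lower bound drops.\<close>
  have "2 * \<alpha> k * \<rho> * w \<le> 2 * \<alpha> k * \<rho> * (2 * \<alpha> i)"
    using a \<rho> IH by (intro mult_left_mono) auto
  then have q'_lower: "2 * \<alpha> i * (1 - 2 * \<rho> * Asum \<alpha> k) \<le> q'"
    using IH(3) unfolding q' by (simp add: algebra_simps)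
  have "\<alpha> i * 1 \<le> \<alpha> i * (2 * (1 - 2 * \<rho> * Asum \<alpha> k))"
    using a \<rho>A by (intro mult_left_mono) auto
  then have q'_ge: "\<alpha> i \<le> q'"
    using q'_lower by (simp add: mult_ac)
  have q'_le: "q' \<le> 2 * \<alpha> i"
    using IH a \<rho> unfolding q' by (smt (verit) mult_nonneg_nonneg)
  have w'_nonneg: "0 \<le> w'"
    unfolding w' using B \<rho>1 IH a q'_ge by simp
  have "(1 - B) * (1 - \<rho>) * w \<le> (1 - B) * 1 * (2 * \<alpha> i)"
    using B \<rho> \<rho>1 IH by (intro mult_mono) auto
  moreover have "B * q' \<le> B * (2 * \<alpha> i)"
    using B q'_le by (intro mult_left_mono)
  ultimately have w'_le: "w' \<le> 2 * \<alpha> i"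
    unfolding w' by (simp add: algebra_simps)
  have AB: "Asum \<alpha> (Suc k) * B = \<alpha> (Suc k)"
    unfolding B_def by (rule Asum_bet)
  then have "Asum \<alpha> (Suc k) * (1 - B) = Asum \<alpha> k"
    by (simp add: Asum_Suc right_diff_distrib)
  with AB have "Asum \<alpha> (Suc k) * w' = Asum \<alpha> k * (1 - \<rho>) * w + \<alpha> (Suc k) * q'"
    unfolding w' distrib_left mult.assoc[symmetric] by simp
  moreover have "\<alpha> (Suc k) * \<alpha> i \<le> \<alpha> (Suc k) * q'"
    using a q'_ge by (intro mult_left_mono) auto
  \<comment> \<open>Damping costs at most \<open>\<alpha> i / 2\<close>. The gain from
    \<open>q'\<close> is \<open>\<alpha> (Suc k) * \<alpha> i\<close>, twice what the induction
    needs, and the spare half covers this cost because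
    \<open>\<alpha> (Suc k) \<ge> 1\<close>.\<close>
  moreover have "\<rho> * Asum \<alpha> k * w \<le> 1 / 4 * (2 * \<alpha> i)"
    using \<rho>A IH a by (intro mult_mono) auto
  moreover have "\<alpha> i * 1 \<le> \<alpha> i * \<alpha> (Suc k)"
    using a by (intro mult_left_mono) auto
  ultimately have "\<alpha> i * (Asum \<alpha> (Suc k) - Asum \<alpha> i) / 2 \<le> Asum \<alpha> (Suc k) * w'"
    using IH(5) by (simp add: Asum_Suc field_simps)
  then show ?case
    using w'_nonneg w'_le q'_lower q'_le by (simp add: w'_def q'_def Asum_Suc)
qed

text \<open>A discrete form of integrating \<open>A - s\<close> from 0 to
  \<open>Asum \<alpha> K\<close>; the sum of squares is the discretisation error. Keeping
  \<open>A\<close> independent of \<open>K\<close> lets the induction go through.\<close>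

lemma sum_Asum_diff:
  "(\<Sum>i\<le>K. \<alpha> i * (A - Asum \<alpha> i)) = A * Asum \<alpha> K - ((Asum \<alpha> K)\<^sup>2 + (\<Sum>i\<le>K. (\<alpha> i)\<^sup>2)) / 2"
proof (induction K)
  case 0
  show ?case by (simp add: Asum_def power2_eq_square algebra_simps)
next
  case (Suc K)
  then show ?case by (simp add: Asum_Suc power2_eq_square field_simps)
qed

text \<open>If no coefficient exceeds half the total, the sum of squares is at most half of the
  squared total. The identity above then leaves a quarter of that square, and dividing by
  \<open>2 * ?A\<close> gives the factor 1/8.\<close>

lemma amplification_ge:
  assumes \<rho>: "0 \<le> \<rho>" "4 * \<rho> * Asum \<alpha> K \<le> 1" and max: "\<And>i. i \<le> K \<Longrightarrow> 2 * \<alpha> i \<le> Asum \<alpha> K"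
  shows "Asum \<alpha> K / 8 \<le> amplification \<alpha> K \<rho>"
proof -
  let ?A = "Asum \<alpha> K"
  have A: "?A > 0"
    using Asum_ge_1[of K] by linarith
  have "(\<Sum>i\<le>K. (\<alpha> i)\<^sup>2) \<le> (\<Sum>i\<le>K. \<alpha> i * (?A / 2))"
    unfolding power2_eq_square using max order_trans[OF zero_le_one alpha_ge_1]
    by (intro sum_mono mult_left_mono) (auto simp: mult.commute)
  also have "\<dots> = ?A\<^sup>2 / 2"
    by (simp only: sum_distrib_right[symmetric] Asum_def[symmetric]) (simp add: power2_eq_square)
  finally have "?A\<^sup>2 / 4 \<le> (\<Sum>i\<le>K. \<alpha> i * (?A - Asum \<alpha> i))"
    unfolding sum_Asum_diff by (simp add: power2_eq_square)
  \<comment> \<open>The term \<open>i = K\<close> vanishes.\<close>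
  also have "\<dots> = (\<Sum>i<K. \<alpha> i * (?A - Asum \<alpha> i))"
    by (simp flip: lessThan_Suc_atMost)
  also have "\<dots> \<le> (\<Sum>i<K. 2 * ?A * \<bar>fst (wq \<alpha> \<rho> i K)\<bar>)"
  proof (rule sum_mono)
    fix i assume "i \<in> {..<K}"
    then show "\<alpha> i * (?A - Asum \<alpha> i) \<le> 2 * ?A * \<bar>fst (wq \<alpha> \<rho> i K)\<bar>"
      using wq_bounds[OF \<rho>, of i K] by simp
  qed
  also have "\<dots> = 2 * ?A * amplification \<alpha> K \<rho>"
    by (simp add: amplification_def sum_distrib_left)
  finally show ?thesis
    using A by (simp add: power2_eq_square)
qed

end

section \<open>Quadratic growth for iOGM-a\<close>

lemma Asum_linear:
  assumes "a > 0"
  shows "Asum (\<lambda>k. (real k + a) / a) K = (real K + 1) * (real K + 2 * a) / (2 * a)"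
  using assms by (induction K) (auto simp: Asum_Suc field_simps, simp add: Asum_def)

text \<open>With curvature \<open>L / (4 * A)\<close> the prefactor is
  \<open>b\<^sup>2 / (8 * A * L)\<close>. Against \<open>(A / 8)\<^sup>2\<close> this leaves
  \<open>b\<^sup>2 * A / (512 * L)\<close>, and \<open>A\<close> is at least
  \<open>(real K)\<^sup>2 / (2 * a)\<close>, hence 1024.\<close>

lemma worst_case_gap_linear_ge:
  assumes V: "subspace V" "x0 \<in> V" and u: "u \<in> V" "norm u = 1"
    and L: "L > 0" and b: "b \<ge> 0" and a: "a > 0" and K: "K \<ge> 3"
  shows "ereal (1 / (1024 * a) * (b\<^sup>2 / L) * (real K)\<^sup>2)
    \<le> worst_case_gap L b V (\<lambda>k. (real k + a) / a) x0 K"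
proof -
  define \<alpha> where "\<alpha> = (\<lambda>k. (real k + a) / a)"
  define A where "A = Asum \<alpha> K"
  define E where "E = amplification \<alpha> K (1 / (4 * A))"
  have alpha: "\<alpha> k \<ge> 1" for k
    using a by (simp add: \<alpha>_def)
  have A_eq: "A = (real K + 1) * (real K + 2 * a) / (2 * a)"
    unfolding A_def \<alpha>_def using a by (rule Asum_linear)
  have A1: "A \<ge> 1"
    unfolding A_def using alpha by (rule Asum_ge_1)
  have "2 * \<alpha> i \<le> A" if "i \<le> K" for i
  proof -
    have "2 * \<alpha> i * (2 * a) \<le> 4 * (real K + a)"
      using that a by (simp add: \<alpha>_def)
    also have "\<dots> \<le> 4 * (real K + 2 * a)"
      using a by simp
    \<comment> \<open>This is where \<open>K \<ge> 3\<close> enters, as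
      \<open>real K + 1 \<ge> 4\<close>.\<close>
    also have "\<dots> \<le> (real K + 1) * (real K + 2 * a)"
      using K a by (intro mult_right_mono) auto
    also have "\<dots> = A * (2 * a)"
      using a by (simp add: A_eq)
    finally show ?thesis
      using a by simp
  qed
  then have "A / 8 \<le> E"
    unfolding E_def A_def using alpha A1
    by (intro amplification_ge) (auto simp: A_def)
  then have "(A / 8)\<^sup>2 \<le> E\<^sup>2"
    using A1 by (intro power_mono) auto
  have "real K * real K \<le> (real K + 1) * (real K + 2 * a)"
    using a by (intro mult_mono) auto
  then have "(real K)\<^sup>2 / (2 * a) \<le> A"
    unfolding A_eq using a by (intro divide_right_mono) (auto simp: power2_eq_square)
  then have "b\<^sup>2 / (512 * L) * ((real K)\<^sup>2 / (2 * a)) \<le> b\<^sup>2 / (512 * L) * A"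
    using L by (intro mult_left_mono) auto
  also have "\<dots> = b\<^sup>2 / (8 * A * L) * (A / 8)\<^sup>2"
    using A1 L by (simp add: power2_eq_square)
  also have "\<dots> \<le> b\<^sup>2 / (8 * A * L) * E\<^sup>2"
    using A1 L \<open>(A / 8)\<^sup>2 \<le> E\<^sup>2\<close> by (intro mult_left_mono) auto
  also have "\<dots> = L / (4 * A) * b\<^sup>2 / (2 * L\<^sup>2) * (amplification \<alpha> K (L / (4 * A) / L))\<^sup>2"
    using A1 L by (simp add: E_def power2_eq_square)
  finally have "1 / (1024 * a) * (b\<^sup>2 / L) * (real K)\<^sup>2 \<le>
      L / (4 * A) * b\<^sup>2 / (2 * L\<^sup>2) * (amplification \<alpha> K (L / (4 * A) / L))\<^sup>2"
    by (simp add: mult_ac)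
  \<comment> \<open>The curvature \<open>L / (4 * A)\<close> is admissible, that is at most
    \<open>L\<close>, because \<open>A \<ge> 1\<close>.\<close>
  also have "ereal \<dots> \<le> worst_case_gap L b V \<alpha> x0 K"
    using V u L b A1 by (intro worst_case_gap_ge) (auto simp: field_simps)
  finally show ?thesis
    by (simp add: \<alpha>_def)
qed

lemma Rd_unit_vector:
  assumes "d > 0"
  obtains u where "u \<in> Rd d" "norm u = 1"
proof
  let ?u = "fin_seq_of (\<lambda>i. if i = 0 then 1 else 0)"
  have c: "coord ?u = (\<lambda>i. if i = 0 then 1 else 0)"
    by (rule coord_fin_seq_of) simp
  show u: "?u \<in> Rd d"
    using assms by (auto simp: Rd_def c)
  have "inner ?u ?u = 1"
    using assms by (simp add: inner_Rd[OF u] c if_distrib[of "\<lambda>x. x * _"] cong: if_cong)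
  then show "norm ?u = 1"
    by (simp add: norm_eq_1)
qed

theorem theorem7:
  shows "(\<forall>(L::real) (b::real) (K::nat) (d::nat) (\<alpha>::nat \<Rightarrow> real). \<forall>x0\<in>Rd d.
            L > 0 \<and> b \<ge> 0 \<and> K \<ge> 1 \<and> d \<ge> 2 \<and> \<alpha> 0 = 1 \<and> (\<forall>k\<le>K. \<alpha> k \<ge> 0) \<longrightarrow>
            worst_case_gap L b (Rd d) \<alpha> x0 K
              \<ge> (SUP l\<in>{0..L}. ereal (l * b\<^sup>2 / (2 * L\<^sup>2) * (amplification \<alpha> K (l / L))\<^sup>2)))
       \<and>
         (\<forall>a::real. a > 0 \<longrightarrow>
            (\<exists>(c::real) (Ka::nat). c > 0 \<and> Ka \<ge> 1 \<and>
              (\<forall>(L::real) (b::real) (K::nat) (d::nat). \<forall>x0\<in>Rd d.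
                 L > 0 \<and> b \<ge> 0 \<and> K \<ge> Ka \<and> d \<ge> 2 \<longrightarrow>
                 worst_case_gap L b (Rd d) (\<lambda>k. (real k + a) / a) x0 K
                   \<ge> ereal (c * (b\<^sup>2 / L) * (real K)\<^sup>2))))"
proof (intro conjI allI ballI impI)
  fix L b :: real and K d :: nat and \<alpha> :: "nat \<Rightarrow> real" and x0
  assume x0: "x0 \<in> Rd d"
    and H: "L > 0 \<and> b \<ge> 0 \<and> K \<ge> 1 \<and> d \<ge> 2 \<and> \<alpha> 0 = 1 \<and> (\<forall>k\<le>K. \<alpha> k \<ge> 0)"
  obtain u where "u \<in> Rd d" "norm u = 1"
    by (rule Rd_unit_vector[of d]) (use H in auto)
  with x0 H show "worst_case_gap L b (Rd d) \<alpha> x0 K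
      \<ge> (SUP l\<in>{0..L}. ereal (l * b\<^sup>2 / (2 * L\<^sup>2) * (amplification \<alpha> K (l / L))\<^sup>2))"
    using subspace_Rd by (intro SUP_least worst_case_gap_ge) auto
next
  fix a :: real
  assume a: "a > 0"
  \<comment> \<open>The witnesses are \<open>1 / (1024 * a)\<close> and 3, both independent of
    \<open>L\<close>, \<open>b\<close>, \<open>d\<close> and \<open>x0\<close>.\<close>
  have "ereal (1 / (1024 * a) * (b\<^sup>2 / L) * (real K)\<^sup>2)
      \<le> worst_case_gap L b (Rd d) (\<lambda>k. (real k + a) / a) x0 K"
    if H: "x0 \<in> Rd d" "L > 0 \<and> b \<ge> 0 \<and> K \<ge> 3 \<and> d \<ge> 2" for L b :: real and K d :: nat and x0
  proof -
    obtain u where "u \<in> Rd d" "norm u = 1"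
      by (rule Rd_unit_vector[of d]) (use H in auto)
    with H a show ?thesis
      using subspace_Rd by (intro worst_case_gap_linear_ge) auto
  qed
  moreover have "1 / (1024 * a) > 0" "(3::nat) \<ge> 1"
    using a by auto
  ultimately show "\<exists>(c::real) (Ka::nat). c > 0 \<and> Ka \<ge> 1 \<and>
      (\<forall>(L::real) (b::real) (K::nat) (d::nat). \<forall>x0\<in>Rd d.
         L > 0 \<and> b \<ge> 0 \<and> K \<ge> Ka \<and> d \<ge> 2 \<longrightarrow>
         worst_case_gap L b (Rd d) (\<lambda>k. (real k + a) / a) x0 K
           \<ge> ereal (c * (b\<^sup>2 / L) * (real K)\<^sup>2))"
    by blast
qed

end
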